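(* Let $d_{\mathrm v}\ge 3$ and $d_{\mathrm r}\ge 2$ be integers, let $\rho_2,\dots,\rho_{d_{\mathrm r}}\ge 0$ be reals with $\sum_{j=2}^{d_{\mathrm r}}\rho_j=1$, and let $R\in(0,1]$ be the rate of a variable-regular, check-irregular $(d_{\mathrm v},\rho(x))$ binary LDPC code, where $\rho_j$ is the fraction of edges belonging to degree-$j$ check nodes. For $E_{\mathrm b}/N_0>0$ let $m_\lambda=4R\,E_{\mathrm b}/N_0$ and let $(m^{(l)})_{l\ge 0}$ be the sequence of check-node output means predicted by (Gaussian-approximation) density evolution, i.e. $m^{(0)}=0$ and, for $l\ge1$, $$m^{(l)}=\sum_{j=2}^{d_{\mathrm r}}\rho_j\,\phi^{-1}\left(1-\left[1-\phi\left(m_\lambda+(d_{\mathrm v}-1)m^{(l-1)}\right)\right]^{j-1}\right).$$ Then for all sufficiently high $E_{\mathrm b}/N_0$ the sequence $m^{(l)}$ asymptotically dominates $(d_{\mathrm v}-1)^l$ after a finite number of iterations. That is, there is a threshold $s_0$ such that for every $E_{\mathrm b}/N_0>s_0$ there exist a real $C>0$ and a finite iteration index $L$ with $$m^{(l)}>C\,(d_{\mathrm v}-1)^l\qquad\text{for all } l\ge L.$$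
   Context: Setting: a binary LDPC code whose Tanner graph has all variable nodes of degree $d_{\mathrm v}$ and check nodes of degrees between $2$ and $d_{\mathrm r}$ (the maximum check degree), with edge-perspective check degree distribution $\rho(x)$ having coefficients $\rho_j$; binary antipodal signaling over the additive white Gaussian noise channel; decoding by the log-likelihood-ratio (LLR) domain sum-product algorithm without saturation. The channel quality is $E_{\mathrm b}/N_0$ (a positive real, on a linear scale), $R$ is the code rate, and the mean channel LLR is $m_\lambda=4R\,E_{\mathrm b}/N_0$. "Density evolution" means the consistent Gaussian approximation to density evolution, in which the mean $m^{(l)}$ of the check-node output LLR at iteration $l$ evolves by the recursion in the claim. The function $\phi:[0,\infty)\to(0,1]$ is $$\phi(x)=\begin{cases}1-\dfrac{1}{\sqrt{4\pi x}}\displaystyle\int_{\mathbb R}\tanh\frac u2\; e^{-\frac{(u-x)^2}{4x}}\,du,& x>0,\\[2mm] 1,& x=0.\end{cases}$$ It is continuous and strictly decreasing from $1$ (at $x=0$) to $0$ (as $x\to\infty$), and $\phi^{-1}:(0,1]\to[0,\infty)$ is its inverse. *)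

theory Defs
  imports "HOL-Analysis.Analysis"
begin

text \<open>For \<open>x > 0\<close> the subtracted term is the mean of \<open>tanh (u / 2)\<close> for a consistent Gaussian LLR \<open>u\<close>,
  i.e. one with mean \<open>x\<close> and variance \<open>2 * x\<close>. Only arguments \<open>x \<ge> 0\<close> are meaningful;
  the value at negative arguments is arbitrary and plays no role.\<close>

definition ga_phi :: "real \<Rightarrow> real" where
  "ga_phi x = (if x > 0
     then 1 - 1 / sqrt (4 * pi * x) *
            (LINT u|lborel. tanh (u / 2) * exp (- ((u - x)\<^sup>2 / (4 * x))))
     else 1)"

text \<open>The inverse of the bijection \<open>ga_phi : [0, \<infinity>) \<rightarrow> (0, 1]\<close>; meaningful on \<open>(0, 1]\<close> only.\<close>

definition ga_phi_inv :: "real \<Rightarrow> real" where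
  "ga_phi_inv = inv_into {0..} ga_phi"

definition mean_channel_llr :: "real \<Rightarrow> real \<Rightarrow> real" where
  "mean_channel_llr R ebn0 = 4 * R * ebn0"

text \<open>Only the values \<open>\<rho> j\<close> for \<open>2 \<le> j \<le> d\<^sub>r\<close> are used.\<close>

primrec check_mean :: "nat \<Rightarrow> nat \<Rightarrow> (nat \<Rightarrow> real) \<Rightarrow> real \<Rightarrow> nat \<Rightarrow> real" where
  "check_mean d\<^sub>v d\<^sub>r \<rho> m_llr 0 = 0"
| "check_mean d\<^sub>v d\<^sub>r \<rho> m_llr (Suc l) =
     (\<Sum>j = 2..d\<^sub>r. \<rho> j *
        ga_phi_inv (1 - (1 - ga_phi (m_llr + (real d\<^sub>v - 1) * check_mean d\<^sub>v d\<^sub>r \<rho> m_llr l)) ^ (j - 1)))"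

end

(* Completing the square turns the defining integral into
   phi x = exp (- x / 4) / sqrt (4 pi x) * (integral of exp (- u^2 / (4 x)) / cosh (u / 2)),
   where the integral is bounded above by a constant and below by a multiple of min 1 (sqrt x).
   Hence phi x lies between B exp (- x / 4) / sqrt (max 1 x) and A exp (- x / 4) / sqrt x, so that
   multiplying phi y by a constant n moves its preimage by at most a constant K. By Bernoulli's inequality
   1 - (1 - phi y)^(j - 1) <= n phi y, so one iteration loses at most K against
   m_lambda + (d_v - 1) m, and for m_lambda >= K + 1 the mean is multiplied by at least d_v - 1. *)
theory Submission
  imports Defs "HOL-Probability.Sinc_Integral"
begin

section \<open>Gaussian-damped integral of the hyperbolic secant\<close>

definition sech_gauss_integral :: "real \<Rightarrow> real" where
  "sech_gauss_integral x = (LINT u|lborel. exp (- (u\<^sup>2 / (4 * x))) / cosh (u / 2))"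

text \<open>The quadratic Taylor bound on exp puts a multiple of the integrable 1 / (1 + u^2) above
  the function. It then serves as a majorant independent of \<open>x\<close>.\<close>

lemma integrable_inverse_cosh_half: "integrable lborel (\<lambda>u::real. 1 / cosh (u / 2))"
proof (rule Bochner_Integration.integrable_bound)
  have "integrable lborel (\<lambda>u::real. inverse (1 + u\<^sup>2))"
    using integrable_inverse_1_plus_square unfolding einterval_eq_UNIV
    by (simp add: set_integrable_def)
  then show "integrable lborel (\<lambda>u::real. 16 * inverse (1 + u\<^sup>2))"
    by (rule integrable_mult_right)
  have meas: "(\<lambda>u::real. 1 / cosh (u / 2)) \<in> borel_measurable borel"
    by (intro borel_measurable_continuous_onI continuous_intros) auto
  then show "(\<lambda>u::real. 1 / cosh (u / 2)) \<in> borel_measurable lborel"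
    by simp
  have "norm (1 / cosh (u / 2)) \<le> norm (16 * inverse (1 + u\<^sup>2))" for u :: real
  proof -
    have "1 + \<bar>u / 2\<bar> + \<bar>u / 2\<bar>\<^sup>2 / 2 \<le> exp \<bar>u / 2\<bar>"
      by (rule exp_lower_Taylor_quadratic) simp
    then have "(1 + u\<^sup>2 / 8) / 2 \<le> exp \<bar>u / 2\<bar> / 2"
      by (simp add: power_divide)
    also have "\<dots> \<le> cosh \<bar>u / 2\<bar>"
      by (simp add: cosh_field_def)
    finally have "(1 + u\<^sup>2) / 16 \<le> cosh (u / 2)"
      using zero_le_power2[of u] by (simp only: cosh_real_abs) (simp add: field_simps)
    moreover have "0 < 1 + u\<^sup>2"
      by (simp add: add_pos_nonneg)
    ultimately have "1 / cosh (u / 2) \<le> 16 / (1 + u\<^sup>2)"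
      by (simp add: field_simps)
    then show ?thesis
      using \<open>0 < 1 + u\<^sup>2\<close> by (simp add: inverse_eq_divide)
  qed
  then show "AE u::real in lborel. norm (1 / cosh (u / 2)) \<le> norm (16 * inverse (1 + u\<^sup>2))"
    by simp
qed

lemma measurable_sech_gauss [measurable]:
  "(\<lambda>u::real. exp (- (u\<^sup>2 / (4 * x))) / cosh (u / 2)) \<in> borel_measurable borel"
  \<comment> \<open>At \<open>x = 0\<close> division by zero makes the exponent 0, so continuity in
    \<open>u\<close> holds there as well.\<close>
  by (cases "x = 0") (auto intro!: borel_measurable_continuous_onI continuous_intros)

lemma sech_gauss_le:
  fixes x u :: real
  assumes "0 \<le> x"
  shows "exp (- (u\<^sup>2 / (4 * x))) / cosh (u / 2) \<le> 1 / cosh (u / 2)"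
  using assms by (intro divide_right_mono) auto

lemma integrable_sech_gauss:
  assumes "0 \<le> x"
  shows "integrable lborel (\<lambda>u::real. exp (- (u\<^sup>2 / (4 * x))) / cosh (u / 2))"
  using integrable_inverse_cosh_half
  by (rule Bochner_Integration.integrable_bound)
     (use sech_gauss_le[OF assms] in auto)

lemma sech_gauss_integral_le:
  assumes "0 \<le> x"
  shows "sech_gauss_integral x \<le> (LINT u|lborel. 1 / cosh (u / 2))"
  unfolding sech_gauss_integral_def
  by (intro integral_mono integrable_sech_gauss integrable_inverse_cosh_half sech_gauss_le assms)

text \<open>On \<open>{0..min 1 (sqrt x)}\<close> both u^2 / (4x) \<le> 1/4 and u / 2 \<le> 1/2
  hold, so the integrand is at least a constant there. The width sqrt x is the scale of the Gaussian
  when \<open>x\<close> is small.\<close>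

lemma sech_gauss_integral_ge:
  assumes "0 < x"
  shows "exp (- 1 / 4) / cosh (1 / 2) * min 1 (sqrt x) \<le> sech_gauss_integral x"
proof -
  let ?d = "min 1 (sqrt x)" and ?c = "exp (- 1 / 4) / cosh (1 / 2) :: real"
  have "?c * ?d = (LINT u|lborel. indicator {0..?d} u * ?c)"
    using assms by simp
  also have "\<dots> \<le> sech_gauss_integral x"
    unfolding sech_gauss_integral_def
  proof (rule integral_mono)
    show "integrable lborel (\<lambda>u. indicator {0..?d} u * ?c)"
      by (intro integrable_mult_left integrable_real_indicator)
         (auto simp: emeasure_lborel_Icc_eq)
    show "integrable lborel (\<lambda>u. exp (- (u\<^sup>2 / (4 * x))) / cosh (u / 2))"
      using assms by (intro integrable_sech_gauss) simp
    show "indicator {0..?d} u * ?c \<le> exp (- (u\<^sup>2 / (4 * x))) / cosh (u / 2)" for u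
    proof (cases "u \<in> {0..?d}")
      case True
      then have u: "0 \<le> u" "u \<le> 1" "u \<le> sqrt x" by auto
      have "u\<^sup>2 \<le> (sqrt x)\<^sup>2" using u by (intro power_mono) auto
      then have "exp (- 1 / 4) \<le> exp (- (u\<^sup>2 / (4 * x)))"
        using assms by (simp add: field_simps)
      moreover have "cosh (u / 2) \<le> cosh (1 / 2)"
        using u by (subst cosh_real_nonneg_le_iff) auto
      ultimately have "?c \<le> exp (- (u\<^sup>2 / (4 * x))) / cosh (u / 2)"
        by (intro frac_le) auto
      then show ?thesis using True by simp
    qed simp
  qed
  finally show ?thesis .
qed

text \<open>Dominated convergence along sequences; the continuity of \<open>ga_phi\<close> derived
  from it feeds the intermediate value theorem.\<close>

lemma continuous_on_sech_gauss_integral: "continuous_on {0<..} sech_gauss_integral"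
proof (rule continuous_on_sequentiallyI)
  fix X :: "nat \<Rightarrow> real" and a
  assume X: "\<forall>n. X n \<in> {0<..}" and a: "a \<in> {0<..}" and lim: "X \<longlonglongrightarrow> a"
  show "(\<lambda>n. sech_gauss_integral (X n)) \<longlonglongrightarrow> sech_gauss_integral a"
    unfolding sech_gauss_integral_def
  proof (rule integral_dominated_convergence[where w = "\<lambda>u. 1 / cosh (u / 2)"])
    show "AE u in lborel. (\<lambda>n. exp (- (u\<^sup>2 / (4 * X n))) / cosh (u / 2))
        \<longlonglongrightarrow> exp (- (u\<^sup>2 / (4 * a))) / cosh (u / 2)"
      using a by (intro always_eventually allI tendsto_intros lim) auto
    show "AE u in lborel. norm (exp (- (u\<^sup>2 / (4 * X n))) / cosh (u / 2)) \<le> 1 / cosh (u / 2)" for n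
      using sech_gauss_le[of "X n"] X by (auto simp: less_imp_le)
  qed (auto simp: integrable_inverse_cosh_half)
qed

section \<open>Closed form of \<open>ga_phi\<close> by completing the square\<close>

lemma one_minus_tanh_half:
  fixes u :: real
  shows "1 - tanh (u / 2) = exp (- u / 2) / cosh (u / 2)"
proof -
  have "cosh (u / 2) - sinh (u / 2) = exp (- u / 2)"
    by (simp add: cosh_minus_sinh)
  then show ?thesis
    using cosh_real_pos[of "u / 2"] by (simp add: tanh_def field_simps)
qed

lemma ga_phi_eq:
  assumes "0 < x"
  shows "ga_phi x = exp (- x / 4) / sqrt (4 * pi * x) * sech_gauss_integral x"
proof -
  let ?N = "normal_density x (sqrt (2 * x))"
  have N: "?N u = 1 / sqrt (4 * pi * x) * exp (- ((u - x)\<^sup>2 / (4 * x)))" for u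
    using assms by (simp add: normal_density_def mult_ac)
  have meas: "(\<lambda>u::real. tanh (u / 2)) \<in> borel_measurable borel"
    by (intro borel_measurable_continuous_onI continuous_intros) auto
  have tanh_le: "\<bar>tanh v\<bar> \<le> 1" for v :: real
    using tanh_real_bounds[of v] by auto
  have intN: "integrable lborel ?N"
    using assms by (intro integrable_normal_density) simp
  have intT: "integrable lborel (\<lambda>u. tanh (u / 2) * ?N u)"
    using intN
  proof (rule Bochner_Integration.integrable_bound)
    show "AE u in lborel. norm (tanh (u / 2) * ?N u) \<le> norm (?N u)"
      using tanh_le by (auto simp: abs_mult intro!: mult_left_le_one_le)
  qed (use meas in measurable)
  have "ga_phi x = 1 - (LINT u|lborel. tanh (u / 2) * ?N u)"
    using assms unfolding N ga_phi_def by (simp flip: integral_mult_right_zero add: mult_ac)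
  \<comment> \<open>Writing 1 as the total mass of the density brings 1 - tanh (u / 2) under the
    integral.\<close>
  also have "\<dots> = (LINT u|lborel. ?N u) - (LINT u|lborel. tanh (u / 2) * ?N u)"
    using assms by (subst integral_normal_density) auto
  also have "\<dots> = (LINT u|lborel. ?N u - tanh (u / 2) * ?N u)"
    using intN intT by simp
  also have "\<dots> = (LINT u|lborel. exp (- x / 4) / sqrt (4 * pi * x) *
                      (exp (- (u\<^sup>2 / (4 * x))) / cosh (u / 2)))"
  proof (rule Bochner_Integration.integral_cong)
    fix u
    \<comment> \<open>The expanded square has linear term u / 2, which the factor exp (- u / 2)
      cancels.\<close>
    have "- ((u - x)\<^sup>2 / (4 * x)) + - u / 2 = - x / 4 + - (u\<^sup>2 / (4 * x))"
      using assms by (simp add: field_simps power2_eq_square)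
    then have e: "exp (- ((u - x)\<^sup>2 / (4 * x))) * exp (- u / 2)
        = exp (- x / 4) * exp (- (u\<^sup>2 / (4 * x)))"
      by (simp only: flip: exp_add)
    have "?N u - tanh (u / 2) * ?N u = ?N u * (1 - tanh (u / 2))"
      by (simp add: algebra_simps)
    also have "\<dots> = 1 / sqrt (4 * pi * x) *
        (exp (- ((u - x)\<^sup>2 / (4 * x))) * exp (- u / 2)) / cosh (u / 2)"
      unfolding N one_minus_tanh_half by simp
    finally show "?N u - tanh (u / 2) * ?N u = exp (- x / 4) / sqrt (4 * pi * x) *
        (exp (- (u\<^sup>2 / (4 * x))) / cosh (u / 2))"
      unfolding e by simp
  qed simp
  also have "\<dots> = exp (- x / 4) / sqrt (4 * pi * x) * sech_gauss_integral x"
    unfolding sech_gauss_integral_def by (rule integral_mult_right_zero)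
  finally show ?thesis .
qed

lemma continuous_on_ga_phi: "continuous_on {0<..} ga_phi"
proof -
  have "continuous_on {0<..} (\<lambda>x. exp (- x / 4) / sqrt (4 * pi * x) * sech_gauss_integral x)"
    by (intro continuous_intros continuous_on_sech_gauss_integral) auto
  then show ?thesis
    by (rule continuous_on_cong[THEN iffD2, rotated 2]) (auto simp: ga_phi_eq)
qed

section \<open>Two-sided exponential bounds\<close>

lemma ga_phi_upper_bound:
  obtains A where "0 < A" "\<And>x. 0 < x \<Longrightarrow> ga_phi x \<le> A * exp (- x / 4) / sqrt x"
proof
  let ?I = "LINT u|lborel. 1 / cosh (u / 2) :: real"
  have "0 \<le> ?I" by (intro integral_nonneg_AE) auto
  \<comment> \<open>Adding 1 turns nonnegativity of the integral into a positive constant.\<close>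
  then show "0 < (?I + 1) / sqrt (4 * pi)"
    by (intro divide_pos_pos add_nonneg_pos) auto
  fix x :: real assume x: "0 < x"
  have "ga_phi x \<le> exp (- x / 4) / sqrt (4 * pi * x) * (?I + 1)"
    unfolding ga_phi_eq[OF x] using sech_gauss_integral_le[of x] x
    by (intro mult_left_mono) auto
  then show "ga_phi x \<le> (?I + 1) / sqrt (4 * pi) * exp (- x / 4) / sqrt x"
    by (simp add: real_sqrt_mult mult_ac)
qed

lemma ga_phi_lower_bound:
  obtains B where "0 < B" "\<And>x. 0 \<le> x \<Longrightarrow> B * exp (- x / 4) / sqrt (max 1 x) \<le> ga_phi x"
proof
  let ?c = "exp (- 1 / 4) / cosh (1 / 2) :: real"
  \<comment> \<open>The cap at 1 covers \<open>x = 0\<close>, where \<open>ga_phi\<close> is 1 by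
    definition.\<close>
  let ?B = "min 1 (?c / sqrt (4 * pi))"
  show "0 < ?B" by simp
  fix x :: real assume x: "0 \<le> x"
  show "?B * exp (- x / 4) / sqrt (max 1 x) \<le> ga_phi x"
  proof (cases "x = 0")
    case True
    then show ?thesis by (simp add: ga_phi_def)
  next
    case False
    with x have x: "0 < x" by simp
    \<comment> \<open>For small \<open>x\<close> the factor sqrt x of the integral bound cancels the
      singularity of 1 / sqrt x.\<close>
    have s: "1 / sqrt (max 1 x) = min 1 (sqrt x) / sqrt x"
      using x by (auto simp: min_def max_def)
    have "?B * exp (- x / 4) / sqrt (max 1 x) \<le> ?c / sqrt (4 * pi) * exp (- x / 4) / sqrt (max 1 x)"
      by (intro divide_right_mono mult_right_mono) auto
    also have "\<dots> = ?c / sqrt (4 * pi) * exp (- x / 4) * (min 1 (sqrt x) / sqrt x)"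
      unfolding s[symmetric] by simp
    also have "\<dots> = exp (- x / 4) / sqrt (4 * pi * x) * (?c * min 1 (sqrt x))"
      by (simp add: real_sqrt_mult mult_ac)
    also have "\<dots> \<le> ga_phi x"
      unfolding ga_phi_eq[OF x] using sech_gauss_integral_ge[OF x] x
      by (intro mult_left_mono) auto
    finally show ?thesis .
  qed
qed

section \<open>Preimages under \<open>ga_phi\<close> and the loss in one iteration\<close>

lemma ga_phi_nonneg: "0 \<le> x \<Longrightarrow> 0 \<le> ga_phi x"
proof -
  assume "0 \<le> x"
  obtain B where "0 < B" "\<And>x. 0 \<le> x \<Longrightarrow> B * exp (- x / 4) / sqrt (max 1 x) \<le> ga_phi x"
    using ga_phi_lower_bound by blast
  with \<open>0 \<le> x\<close> show ?thesis
    by (metis divide_nonneg_nonneg exp_ge_zero less_imp_le mult_nonneg_nonneg order_trans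
        real_sqrt_ge_zero max.coboundedI2)
qed

text \<open>Keeps 1 - \<open>ga_phi y\<close> in [0, 1] for large \<open>y\<close>, the range in
  which its powers decrease and Bernoulli's inequality applies.\<close>

lemma ga_phi_eventually_le_1: "\<exists>K. \<forall>y\<ge>K. ga_phi y \<le> 1"
proof -
  obtain A where A: "0 < A" "\<And>x. 0 < x \<Longrightarrow> ga_phi x \<le> A * exp (- x / 4) / sqrt x"
    using ga_phi_upper_bound by blast
  have "ga_phi y \<le> 1" if "A\<^sup>2 \<le> y" for y
  proof -
    have "0 < A\<^sup>2" using A(1) by simp
    with that have y: "0 < y" by linarith
    have "A * exp (- y / 4) \<le> A * 1"
      using A(1) y by (intro mult_left_mono) auto
    also have "\<dots> \<le> sqrt y"
      using that A(1) by (simp add: real_le_rsqrt)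
    finally have "A * exp (- y / 4) / sqrt y \<le> 1"
      using y by simp
    with A(2)[OF y] show ?thesis by linarith
  qed
  then show ?thesis by blast
qed

lemma ga_phi_le_mult_imp_shift:
  assumes "0 < n"
  shows "\<exists>K\<ge>1. \<forall>x\<ge>0. \<forall>y\<ge>1. ga_phi x \<le> n * ga_phi y \<longrightarrow> y - x < K"
proof -
  obtain A where A: "0 < A" "\<And>x. 0 < x \<Longrightarrow> ga_phi x \<le> A * exp (- x / 4) / sqrt x"
    using ga_phi_upper_bound by blast
  obtain B where B: "0 < B" "\<And>x. 0 \<le> x \<Longrightarrow> B * exp (- x / 4) / sqrt (max 1 x) \<le> ga_phi x"
    using ga_phi_lower_bound by blast
  \<comment> \<open>\<open>M\<close> \<ge> 1 makes \<open>ln M\<close> nonnegative, so that the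
    negated claim also yields x \<le> y.\<close>
  define M where "M = max 1 (n * A / B)"
  have M: "1 \<le> M" "n * A \<le> M * B"
    using B(1) by (auto simp: M_def max_def field_simps)
  have "y - x < 1 + 4 * ln M" if xy: "0 \<le> x" "1 \<le> y" "ga_phi x \<le> n * ga_phi y" for x y
  proof (rule ccontr)
    assume "\<not> ?thesis"
    moreover have "0 \<le> ln M" using M by simp
    ultimately have le: "x \<le> y" "ln M < (y - x) / 4" by auto
    \<comment> \<open>Since x \<le> y and 1 \<le> y, both bounds get the common denominator sqrt y;
      once it cancels, only the exponentials remain to be compared.\<close>
    have "B * exp (- x / 4) / sqrt y \<le> B * exp (- x / 4) / sqrt (max 1 x)"
      using B(1) le xy by (intro divide_left_mono) auto
    also have "\<dots> \<le> n * ga_phi y"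
      using B(2)[OF xy(1)] xy(3) by linarith
    also have "\<dots> \<le> n * (A * exp (- y / 4) / sqrt y)"
      using A(2)[of y] xy(2) assms by (intro mult_left_mono) auto
    finally have "B * exp (- x / 4) \<le> (n * A) * exp (- y / 4)"
      using xy(2) by (simp add: field_simps)
    also have "\<dots> \<le> (M * B) * exp (- y / 4)"
      using M(2) by (intro mult_right_mono) auto
    finally have "exp (- x / 4) \<le> M * exp (- y / 4)"
      using B(1) by simp
    then have "exp (- x / 4) * exp (y / 4) \<le> (M * exp (- y / 4)) * exp (y / 4)"
      by (intro mult_right_mono) auto
    also have "\<dots> = M" by (simp flip: exp_add)
    finally have "exp ((y - x) / 4) \<le> M"
      by (simp add: diff_divide_distrib flip: exp_add)
    then have "(y - x) / 4 \<le> ln M"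
      using M(1) by (subst ln_ge_iff) auto
    with le show False by simp
  qed
  then show ?thesis
    using M(1) by (intro exI[of _ "1 + 4 * ln M"]) auto
qed

text \<open>The argument of the inverse lies between \<open>ga_phi y\<close> and
  \<open>n * ga_phi y\<close>, hence has a preimage. The shift bound holds for every nonnegative
  preimage, in particular for the one that \<open>inv_into\<close> selects.\<close>

lemma ga_phi_inv_shift:
  fixes n :: nat
  shows "\<exists>K\<ge>1. \<forall>y>K. \<forall>k\<in>{1..n}. y - K \<le> ga_phi_inv (1 - (1 - ga_phi y) ^ k)"
proof (cases "n = 0")
  case False
  obtain K\<^sub>1 where K\<^sub>1: "1 \<le> K\<^sub>1"
    "\<And>x y. 0 \<le> x \<Longrightarrow> 1 \<le> y \<Longrightarrow> ga_phi x \<le> real n * ga_phi y \<Longrightarrow> y - x < K\<^sub>1"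
    using ga_phi_le_mult_imp_shift[of "real n"] False by auto
  obtain K\<^sub>2 where K\<^sub>2: "\<And>y. K\<^sub>2 \<le> y \<Longrightarrow> ga_phi y \<le> 1"
    using ga_phi_eventually_le_1 by blast
  define K where "K = max K\<^sub>1 K\<^sub>2"
  have "y - K \<le> ga_phi_inv (1 - (1 - ga_phi y) ^ k)" if y: "K < y" and k: "k \<in> {1..n}" for y k
  proof -
    define v where "v = 1 - (1 - ga_phi y) ^ k"
    have y1: "1 \<le> y" "K\<^sub>1 < y" and p: "0 \<le> ga_phi y" "ga_phi y \<le> 1"
      using y K\<^sub>1(1) K\<^sub>2[of y] ga_phi_nonneg[of y] by (auto simp: K_def)
    have "(1 - ga_phi y) ^ k \<le> (1 - ga_phi y) ^ 1"
      using p k by (intro power_decreasing) auto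
    then have v_ge: "ga_phi y \<le> v" by (simp add: v_def)
    have "1 + real k * (- ga_phi y) \<le> (1 + - ga_phi y) ^ k"
      using p by (intro Bernoulli_inequality) auto
    then have "v \<le> real k * ga_phi y" by (simp add: v_def)
    also have "\<dots> \<le> real n * ga_phi y"
      using k p by (intro mult_right_mono) auto
    finally have v_le: "v \<le> real n * ga_phi y" .
    \<comment> \<open>Contrapositive of the shift bound: the distance from
      \<open>y - K\<^sub>1\<close> to \<open>y\<close> is exactly \<open>K\<^sub>1\<close>, not
      less.\<close>
    have "real n * ga_phi y < ga_phi (y - K\<^sub>1)"
      using K\<^sub>1(2)[of "y - K\<^sub>1" y] y1 by force
    \<comment> \<open>The endpoint values enclose \<open>v\<close>, and the interval lies in the
      positive half-line, where continuity is available.\<close>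
    then have "\<exists>x\<ge>y - K\<^sub>1. x \<le> y \<and> ga_phi x = v"
      using v_ge v_le y1 K\<^sub>1(1)
      by (intro IVT2' continuous_on_subset[OF continuous_on_ga_phi]) auto
    then have v_range: "v \<in> ga_phi ` {0..}"
      using y1 by force
    then have "ga_phi (ga_phi_inv v) = v" "0 \<le> ga_phi_inv v"
      using f_inv_into_f[OF v_range] inv_into_into[OF v_range] by (simp_all add: ga_phi_inv_def)
    then have "y - ga_phi_inv v < K\<^sub>1"
      using K\<^sub>1(2)[of "ga_phi_inv v" y] y1 v_le by simp
    then show ?thesis by (simp add: v_def K_def)
  qed
  moreover have "1 \<le> K" using K\<^sub>1(1) by (simp add: K_def)
  ultimately show ?thesis by blast
qed auto

section \<open>Geometric growth of the check-node means\<close>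

theorem theorem5:
  fixes d\<^sub>v d\<^sub>r :: nat and \<rho> :: "nat \<Rightarrow> real" and R :: real
  assumes "d\<^sub>v \<ge> 3" and "d\<^sub>r \<ge> 2"
    and "\<And>j. j \<in> {2..d\<^sub>r} \<Longrightarrow> \<rho> j \<ge> 0"
    and "(\<Sum>j = 2..d\<^sub>r. \<rho> j) = 1"
    and "0 < R" and "R \<le> 1"
  shows "\<exists>s\<^sub>0::real. \<forall>ebn0::real. ebn0 > 0 \<and> ebn0 > s\<^sub>0 \<longrightarrow>
           (\<exists>C::real. C > 0 \<and> (\<exists>L::nat. \<forall>l\<ge>L.
              check_mean d\<^sub>v d\<^sub>r \<rho> (mean_channel_llr R ebn0) l > C * (real d\<^sub>v - 1) ^ l))"
proof -
  obtain K where K: "1 \<le> K"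
    "\<And>y k. K < y \<Longrightarrow> k \<in> {1..d\<^sub>r} \<Longrightarrow> y - K \<le> ga_phi_inv (1 - (1 - ga_phi y) ^ k)"
    using ga_phi_inv_shift[of d\<^sub>r] by blast
  define q where "q = real d\<^sub>v - 1"
  have q: "1 < q" using assms(1) by (simp add: q_def)
  \<comment> \<open>The threshold makes the channel mean exceed \<open>K + 1\<close>:
    \<open>K\<close> pays for the loss of one iteration and 1 is left over.\<close>
  show ?thesis
  proof (rule exI[of _ "(K + 1) / (4 * R)"], intro allI impI)
    fix ebn0 :: real
    assume "ebn0 > 0 \<and> ebn0 > (K + 1) / (4 * R)"
    then have llr: "K + 1 < mean_channel_llr R ebn0"
      using assms(5) by (simp add: mean_channel_llr_def field_simps)
    let ?m = "check_mean d\<^sub>v d\<^sub>r \<rho> (mean_channel_llr R ebn0)"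
    \<comment> \<open>The summand 1 lifts the sequence off its start at 0, where multiplication by
      \<open>q\<close> alone gives nothing.\<close>
    have step: "1 + q * ?m l \<le> ?m (Suc l)" if "0 \<le> ?m l" for l
    proof -
      define y where "y = mean_channel_llr R ebn0 + q * ?m l"
      have "0 \<le> q * ?m l" using that q by simp
      then have y: "K < y" "1 + q * ?m l \<le> y - K"
        using llr by (auto simp: y_def)
      \<comment> \<open>The weights sum to 1, so a bound common to all check degrees passes to their
        average; the exponents \<open>j - 1\<close> lie in \<open>{1..d\<^sub>r}\<close>.\<close>
      have "y - K = (\<Sum>j = 2..d\<^sub>r. \<rho> j * (y - K))"
        using assms(4) by (simp flip: sum_distrib_right)
      also have "\<dots> \<le> (\<Sum>j = 2..d\<^sub>r. \<rho> j * ga_phi_inv (1 - (1 - ga_phi y) ^ (j - 1)))"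
        using y(1) by (intro sum_mono mult_left_mono K(2) assms(3)) auto
      also have "\<dots> = ?m (Suc l)" by (simp add: y_def q_def)
      finally show ?thesis using y(2) by linarith
    qed
    have growth: "q ^ l \<le> ?m (Suc l)" for l
    proof (induction l)
      case 0
      show ?case using step[of 0] by simp
    next
      case (Suc l)
      have "0 \<le> q ^ l" using q by simp
      with Suc.IH have "0 \<le> ?m (Suc l)" by linarith
      moreover have "q * q ^ l \<le> q * ?m (Suc l)"
        using Suc.IH q by (intro mult_left_mono) auto
      ultimately show ?case using step[of "Suc l"] by simp
    qed
    \<comment> \<open>In \<open>C = 1 / (2 * q)\<close> the factor \<open>q\<close> offsets the
      index shift in \<open>growth\<close> and the 2 gives strictness. The bound starts at
      \<open>l = 1\<close> because the initial mean is 0.\<close>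
    have "1 / (2 * q) * q ^ l < ?m l" if l: "1 \<le> l" for l
    proof -
      obtain k where k: "l = Suc k" using l by (cases l) auto
      have "1 / (2 * q) * q ^ l = q ^ k / 2" using q by (simp add: k)
      also have "\<dots> < q ^ k" using q by simp
      finally show ?thesis using growth[of k] by (simp add: k)
    qed
    then show "\<exists>C>0. \<exists>L. \<forall>l\<ge>L. C * (real d\<^sub>v - 1) ^ l < ?m l"
      using q unfolding q_def[symmetric]
      by (intro exI[of _ "1 / (2 * q)"] conjI exI[of _ 1] allI impI) auto
  qed
qed

end
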